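(* Let $S\in\mathbf{R}^{n\times n}$ and $Q\in\mathbf{R}^{n\times n}$ be two positive definite matrices. Then $Q<S^{-1}$ if and only if there exists a matrix $R\in\mathbf{R}^{n\times n}$ such that $$R^{\mathrm{T}}QR+S-\left(R+R^{\mathrm{T}}\right)<0.$$ The same holds with non-strict inequalities: $Q\le S^{-1}$ if and only if there exists a matrix $R\in\mathbf{R}^{n\times n}$ such that $R^{\mathrm{T}}QR+S-(R+R^{\mathrm{T}})\le 0$.
   Context: Positive definite matrices are real symmetric; for symmetric matrices, $X<Y$ (resp. $X\le Y$) means that $Y-X$ is positive definite (resp. positive semidefinite). *)

theory Defs
  imports "HOL-Analysis.Analysis"
begin

definition positive_definite :: "real^'n^'n \<Rightarrow> bool" where
  "positive_definite A \<longleftrightarrow>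
     transpose A = A \<and> (\<forall>x. x \<noteq> 0 \<longrightarrow> 0 < x \<bullet> (A *v x))"

definition positive_semidefinite :: "real^'n^'n \<Rightarrow> bool" where
  "positive_semidefinite A \<longleftrightarrow>
     transpose A = A \<and> (\<forall>x. 0 \<le> x \<bullet> (A *v x))"

(* The library's < and \<le> on vectors, hence on matrices, are componentwise, so the
   order of symmetric matrices gets its own symbols.  The strict relation is not
   "\<preceq> and distinct". *)

definition loewner_less :: "real^'n^'n \<Rightarrow> real^'n^'n \<Rightarrow> bool" (infix "\<prec>" 50) where
  "X \<prec> Y \<longleftrightarrow> positive_definite (Y - X)"

definition loewner_le :: "real^'n^'n \<Rightarrow> real^'n^'n \<Rightarrow> bool" (infix "\<preceq>" 50) where
  "X \<preceq> Y \<longleftrightarrow> positive_semidefinite (Y - X)"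

end

theory Submission
  imports Defs
begin

text \<open>
  For symmetric \<open>S\<close> and \<open>Q\<close>, with \<open>S\<close> invertible, and for \<open>x = Q y\<close>,
  \[ y^T (S^{-1} - Q) y = - x^T (R^T Q R + S - R - R^T) x
       + (R x - y)^T Q (R x - y) + (S^{-1} y - x)^T S (S^{-1} y - x), \]
  where the last two terms are nonnegative when \<open>Q\<close> and \<open>S\<close> are positive definite
  (\<open>completed_squares_identity\<close>).  Hence any \<open>R\<close> that makes the first term nonnegative
  for all \<open>x\<close> gives \<open>Q \<preceq> S\<^sup>-\<^sup>1\<close>, and strictness survives because \<open>Q\<close> is injective.
  Conversely \<open>R = S\<close> always serves as a witness: then the matrix in question is
  \<open>S Q S - S\<close>, the congruence of \<open>Q - S\<^sup>-\<^sup>1\<close> by the injective symmetric matrix \<open>S\<close>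
  (\<open>witness_identity\<close>).
\<close>

lemma positive_definite_mult_nonzero:
  fixes A :: "real^'n^'n"
  assumes "positive_definite A" "x \<noteq> 0"
  shows "A *v x \<noteq> 0"
  using assms unfolding positive_definite_def by (metis inner_zero_right less_irrefl)

lemma positive_definite_nonneg:
  fixes A :: "real^'n^'n"
  assumes "positive_definite A"
  shows "0 \<le> x \<bullet> (A *v x)"
  using assms unfolding positive_definite_def
  by (cases "x = 0") (auto intro: less_imp_le)

lemma positive_definite_invertible:
  fixes A :: "real^'n^'n"
  assumes "positive_definite A"
  shows "invertible A"
  using positive_definite_mult_nonzero[OF assms]
  by (metis invertible_left_inverse matrix_left_invertible_ker)

lemma matrix_inv_mult:
  fixes A :: "real^'n^'n"
  assumes "invertible A"
  shows "A ** matrix_inv A = mat 1" "matrix_inv A ** A = mat 1"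
proof -
  have "\<exists>B. A ** B = mat 1 \<and> B ** A = mat 1"
    using assms by (simp add: invertible_def)
  from someI_ex[OF this] show "A ** matrix_inv A = mat 1" "matrix_inv A ** A = mat 1"
    by (simp_all add: matrix_inv_def)
qed

lemma transpose_add: "transpose (A + B) = transpose A + transpose (B :: real^'n^'m)"
  by (simp add: transpose_def vec_eq_iff)

lemma transpose_diff: "transpose (A - B) = transpose A - transpose (B :: real^'n^'m)"
  by (simp add: transpose_def vec_eq_iff)

lemma transpose_matrix_inv_symmetric:
  fixes A :: "real^'n^'n"
  assumes "invertible A" "transpose A = A"
  shows "transpose (matrix_inv A) = matrix_inv A"
proof -
  have "transpose (matrix_inv A) ** A = mat 1"
    using arg_cong[OF matrix_inv_mult(1)[OF assms(1)], of transpose] assms(2)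
    by (simp add: matrix_transpose_mul transpose_mat)
  then have "(transpose (matrix_inv A) ** A) ** matrix_inv A = matrix_inv A"
    by simp
  then show ?thesis
    by (simp add: matrix_inv_mult(1)[OF assms(1)] flip: matrix_mul_assoc)
qed

lemma symmetric_inner_commute:
  fixes A :: "real^'n^'n"
  assumes "transpose A = A"
  shows "x \<bullet> (A *v y) = y \<bullet> (A *v x)"
  using assms by (metis dot_lmul_matrix inner_commute transpose_matrix_vector)

lemma riccati_quadratic_form:
  fixes S Q R :: "real^'n^'n"
  shows "x \<bullet> ((0 - (transpose R ** Q ** R + S - (R + transpose R))) *v x) =
    2 * (x \<bullet> (R *v x)) - (R *v x) \<bullet> (Q *v (R *v x)) - x \<bullet> (S *v x)"
proof -
  have t: "x \<bullet> (z v* R) = (R *v x) \<bullet> z" for z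
    by (metis dot_lmul_matrix inner_commute)
  show ?thesis
    by (simp add: matrix_vector_mult_diff_rdistrib matrix_vector_mult_add_rdistrib
        inner_diff_right inner_add_right t inner_commute[of "R *v x" x]
        flip: matrix_vector_mul_assoc)
qed

lemma transpose_riccati:
  fixes S Q R :: "real^'n^'n"
  assumes "transpose S = S" "transpose Q = Q"
  defines "M \<equiv> 0 - (transpose R ** Q ** R + S - (R + transpose R))"
  shows "transpose M = M"
proof -
  have "transpose (0 :: real^'n^'n) = 0"
    by (simp add: transpose_def vec_eq_iff)
  then show ?thesis
    by (simp add: M_def assms transpose_diff transpose_add matrix_transpose_mul
        matrix_mul_assoc add.commute)
qed

text \<open>
  With \<open>x = Q y\<close> the mixed term \<open>y\<^sup>T Q R x\<close> of the first square is \<open>x\<^sup>T R x\<close>, which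
  cancels the linear term in \<open>R\<close>.  The mixed term \<open>z\<^sup>T S x\<close> of the second square is
  \<open>y\<^sup>T Q y\<close>, so that its contribution turns the \<open>+ y\<^sup>T Q y\<close> of the first square
  into the required \<open>- y\<^sup>T Q y\<close>.
\<close>

lemma completed_squares_identity:
  fixes S Q R :: "real^'n^'n" and y :: "real^'n"
  assumes "invertible S" "transpose S = S" "transpose Q = Q"
  defines "x \<equiv> Q *v y" and "z \<equiv> matrix_inv S *v y"
  shows "y \<bullet> ((matrix_inv S - Q) *v y) =
    x \<bullet> ((0 - (transpose R ** Q ** R + S - (R + transpose R))) *v x)
    + (R *v x - y) \<bullet> (Q *v (R *v x - y)) + (z - x) \<bullet> (S *v (z - x))"
proof -
  have Sz: "S *v z = y"
    by (simp add: z_def matrix_vector_mul_assoc matrix_inv_mult[OF assms(1)])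
  have "z \<bullet> (S *v x) = x \<bullet> y"
    using symmetric_inner_commute[OF assms(2), of z x] Sz by simp
  moreover have "y \<bullet> (Q *v (R *v x)) = x \<bullet> (R *v x)"
    using symmetric_inner_commute[OF assms(3), of y "R *v x"]
    by (simp add: x_def inner_commute)
  ultimately show ?thesis
    unfolding riccati_quadratic_form
    by (simp add: matrix_vector_mult_diff_rdistrib matrix_vector_mult_diff_distrib
        inner_diff_left inner_diff_right Sz inner_commute
        flip: x_def z_def)
qed

lemma witness_identity:
  fixes S Q :: "real^'n^'n"
  assumes "invertible S" "transpose S = S"
  shows "x \<bullet> ((0 - (transpose S ** Q ** S + S - (S + transpose S))) *v x) =
    (S *v x) \<bullet> ((matrix_inv S - Q) *v (S *v x))"
proof -
  have "matrix_inv S *v (S *v x) = x"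
    by (simp add: matrix_vector_mul_assoc matrix_inv_mult[OF assms(1)])
  then show ?thesis
    unfolding riccati_quadratic_form
    by (simp add: matrix_vector_mult_diff_rdistrib inner_diff_right inner_commute)
qed

theorem lemma2:
  fixes S Q :: "real^'n^'n"
  assumes "positive_definite S"
    and "positive_definite Q"
  shows "(Q \<prec> matrix_inv S \<longleftrightarrow>
            (\<exists>R :: real^'n^'n. transpose R ** Q ** R + S - (R + transpose R) \<prec> 0)) \<and>
         (Q \<preceq> matrix_inv S \<longleftrightarrow>
            (\<exists>R :: real^'n^'n. transpose R ** Q ** R + S - (R + transpose R) \<preceq> 0))"
proof -
  have S: "transpose S = S" and Q: "transpose Q = Q"
    using assms by (simp_all add: positive_definite_def)
  note inv = positive_definite_invertible[OF assms(1)]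
  have sym: "transpose (matrix_inv S - Q) = matrix_inv S - Q"
    by (simp add: transpose_diff Q transpose_matrix_inv_symmetric[OF inv S])
  have lower: "(Q *v y) \<bullet> ((0 - (transpose R ** Q ** R + S - (R + transpose R))) *v (Q *v y))
      \<le> y \<bullet> ((matrix_inv S - Q) *v y)" for R :: "real^'n^'n" and y
    using completed_squares_identity[OF inv S Q, of y R]
      positive_definite_nonneg[OF assms(2), of "R *v (Q *v y) - y"]
      positive_definite_nonneg[OF assms(1), of "matrix_inv S *v y - Q *v y"]
    by linarith
  have "transpose S ** Q ** S + S - (S + transpose S) \<prec> 0" if "Q \<prec> matrix_inv S"
    using that positive_definite_mult_nonzero[OF assms(1)]
    unfolding loewner_less_def positive_definite_def witness_identity[OF inv S]
    by (metis transpose_riccati[OF S Q])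
  moreover have "Q \<prec> matrix_inv S"
    if "transpose R ** Q ** R + S - (R + transpose R) \<prec> 0" for R :: "real^'n^'n"
    using that sym lower[of _ R] positive_definite_mult_nonzero[OF assms(2)]
    unfolding loewner_less_def positive_definite_def by (meson less_le_trans)
  moreover have "transpose S ** Q ** S + S - (S + transpose S) \<preceq> 0" if "Q \<preceq> matrix_inv S"
    using that
    unfolding loewner_le_def positive_semidefinite_def witness_identity[OF inv S]
    by (metis transpose_riccati[OF S Q])
  moreover have "Q \<preceq> matrix_inv S"
    if "transpose R ** Q ** R + S - (R + transpose R) \<preceq> 0" for R :: "real^'n^'n"
    using that sym lower[of _ R]
    unfolding loewner_le_def positive_semidefinite_def by (meson order_trans)
  ultimately show ?thesis
    by blast
qed

end
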